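(* Let $\mathfrak n$ be a $7$-dimensional real $2$-step nilpotent Lie algebra with derived algebra $\mathfrak n'=[\mathfrak n,\mathfrak n]$, and let $\varphi\in\Lambda^3\mathfrak n^*$ be a $\mathrm G_2T$-structure on $\mathfrak n$. If either $\dim(\mathfrak n')\le 2$, or $\dim(\mathfrak n')=3$ and $\varphi$ calibrates $\mathfrak n'$, then $\varphi$ is coclosed, i.e. $d*\varphi=0$.
   Context: A $\mathrm G_2$-structure on a $7$-dimensional real Lie algebra $\mathfrak n$ is a form $\varphi\in\Lambda^3\mathfrak n^*$ such that there is a basis of $\mathfrak n$ whose dual basis $\{e^1,\dots,e^7\}$ satisfies $\varphi=e^{127}+e^{347}+e^{567}+e^{135}-e^{245}-e^{146}-e^{236}$ (where $e^{ijk}=e^i\wedge e^j\wedge e^k$). It determines a metric $g_\varphi$ and an orientation on $\mathfrak n$ for which such a basis is oriented orthonormal; $*$ is the corresponding Hodge operator and $\psi=*\varphi$. The operator $d$ is the Chevalley--Eilenberg differential of $\mathfrak n$ (so $d\beta(x,y)=-\beta([x,y])$ for $\beta\in\mathfrak n^*$); equivalently, one works with left-invariant forms on the simply connected Lie group with Lie algebra $\mathfrak n$. Set $\tau_1=\frac1{12}*(\varphi\wedge *d\varphi)$. The $\mathrm G_2$-structure $\varphi$ is called a $\mathrm G_2T$-structure ($\mathrm G_2$-structure with torsion) if $d\psi=4\tau_1\wedge\psi$ (equivalently, its intrinsic torsion $2$-form $\tau_2$, defined by $d\psi=4\tau_1\wedge\psi-*\tau_2$, vanishes). $\mathfrak n$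 is $2$-step nilpotent if $\{0\}\ne\mathfrak n'$ and $\mathfrak n'$ is contained in the center of $\mathfrak n$. When $\dim(\mathfrak n')=3$, $\varphi$ calibrates $\mathfrak n'$ if $\varphi$ restricts to a (metric) volume form on $\mathfrak n'$, i.e. $|\varphi(z_1,z_2,z_3)|=1$ for a $g_\varphi$-orthonormal basis $\{z_1,z_2,z_3\}$ of $\mathfrak n'$. *)

theory Defs
  imports "HOL-Analysis.Analysis"
begin

section \<open>Lie algebras\<close>

definition lie_bracket :: "('a::real_vector \<Rightarrow> 'a \<Rightarrow> 'a) \<Rightarrow> bool" where
  "lie_bracket br \<longleftrightarrow>
     bilinear br \<and> (\<forall>x. br x x = 0) \<and>
     (\<forall>x y z. br x (br y z) + br y (br z x) + br z (br x y) = 0)"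

definition derived_algebra :: "('a::real_vector \<Rightarrow> 'a \<Rightarrow> 'a) \<Rightarrow> 'a set" where
  "derived_algebra br = span {br x y | x y. True}"

definition lie_center :: "('a::real_vector \<Rightarrow> 'a \<Rightarrow> 'a) \<Rightarrow> 'a set" where
  "lie_center br = {z. \<forall>x. br z x = 0}"

definition two_step_nilpotent :: "('a::real_vector \<Rightarrow> 'a \<Rightarrow> 'a) \<Rightarrow> bool" where
  "two_step_nilpotent br \<longleftrightarrow>
     derived_algebra br \<noteq> {0} \<and> derived_algebra br \<subseteq> lie_center br"


section \<open>Exterior forms\<close>

text \<open>
  A form takes the list of its arguments and is \<open>0\<close> on lists whose length differs from its
  degree. The operations below need no degree argument, and two forms are equal if and only if
  they are equal as functions.
\<close>

type_synonym 'a form = "'a list \<Rightarrow> real"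

definition alternating_form :: "nat \<Rightarrow> 'a::real_vector form \<Rightarrow> bool" where
  "alternating_form k \<omega> \<longleftrightarrow>
     (\<forall>xs. length xs \<noteq> k \<longrightarrow> \<omega> xs = 0) \<and>
     (\<forall>xs i. length xs = k \<longrightarrow> i < k \<longrightarrow> linear (\<lambda>x. \<omega> (xs[i := x]))) \<and>
     (\<forall>xs. length xs = k \<longrightarrow> \<not> distinct xs \<longrightarrow> \<omega> xs = 0)"

text \<open>
  The sum over shuffles, without a factorial factor: on one-forms,
  \<open>(\<alpha>\<^sub>1 \<and> \<dots> \<and> \<alpha>\<^sub>k)(x\<^sub>1, \<dots>, x\<^sub>k) = det (\<alpha>\<^sub>i(x\<^sub>j))\<close>. The set \<open>I\<close> holds the positions of the arguments
  passed to \<open>\<alpha>\<close>, and the exponent counts the inversions of the shuffle.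
\<close>

definition wedge :: "'a form \<Rightarrow> 'a form \<Rightarrow> 'a form" where
  "wedge \<alpha> \<beta> = (\<lambda>xs. \<Sum>I\<in>Pow {..<length xs}.
     (-1) ^ card {(i, j). i \<in> I \<and> j \<in> {..<length xs} - I \<and> j < i} *
     \<alpha> (nths xs I) * \<beta> (nths xs ({..<length xs} - I)))"

text \<open>
  The Chevalley-Eilenberg differential. Counting positions from \<open>0\<close> instead of \<open>1\<close> does not
  change the parity of \<open>i + j\<close>; on a one-form, \<open>d\<beta>(x, y) = - \<beta>([x, y])\<close>.
\<close>

definition ce_diff :: "('a \<Rightarrow> 'a \<Rightarrow> 'a) \<Rightarrow> 'a form \<Rightarrow> 'a form" where
  "ce_diff br \<omega> = (\<lambda>xs. \<Sum>(i, j) | i < j \<and> j < length xs.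
     (-1) ^ (i + j) * \<omega> (br (xs ! i) (xs ! j) # nths xs (- {i, j})))"


section \<open>Frames and the Hodge operator\<close>

definition is_frame :: "(nat \<Rightarrow> 'a::real_vector) \<Rightarrow> bool" where
  "is_frame e \<longleftrightarrow> inj_on e {1..7} \<and> independent (e ` {1..7}) \<and> span (e ` {1..7}) = UNIV"

definition dual_coord :: "(nat \<Rightarrow> 'a::real_vector) \<Rightarrow> nat \<Rightarrow> 'a \<Rightarrow> real" where
  "dual_coord e i x = representation (e ` {1..7}) x (e i)"

definition dual_form :: "(nat \<Rightarrow> 'a::real_vector) \<Rightarrow> nat \<Rightarrow> 'a form" where
  "dual_form e i = (\<lambda>xs. case xs of [x] \<Rightarrow> dual_coord e i x | _ \<Rightarrow> 0)"

text \<open>\<open>frame_form e [i\<^sub>1, \<dots>, i\<^sub>k]\<close> is \<open>e\<^sup>i\<^sup>1 \<and> \<dots> \<and> e\<^sup>i\<^sup>k\<close>; the empty product is the constant \<open>1\<close> of degree \<open>0\<close>.\<close>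

fun frame_form :: "(nat \<Rightarrow> 'a::real_vector) \<Rightarrow> nat list \<Rightarrow> 'a form" where
  "frame_form e [] = (\<lambda>xs. if xs = [] then 1 else 0)"
| "frame_form e (i # is) = wedge (dual_form e i) (frame_form e is)"

text \<open>
  The Hodge operator of the metric and orientation for which \<open>e\<close> is oriented orthonormal: the
  linear map with \<open>* e\<^sup>I = \<epsilon> e\<^sup>J\<close>, where \<open>J\<close> is the complement of \<open>I\<close> and \<open>e\<^sup>I \<and> e\<^sup>J = \<epsilon> e\<^sup>1\<^sup>2\<^sup>3\<^sup>4\<^sup>5\<^sup>6\<^sup>7\<close>.
  The factor \<open>\<omega> (map e is)\<close> is the coefficient of \<open>\<omega>\<close> at \<open>e\<^sup>I\<close>, and \<open>e\<^sup>1\<^sup>2\<^sup>3\<^sup>4\<^sup>5\<^sup>6\<^sup>7 (map e is @ xs)\<close> is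
  \<open>\<epsilon> e\<^sup>J(xs)\<close>.
\<close>

definition frame_hodge :: "(nat \<Rightarrow> 'a::real_vector) \<Rightarrow> 'a form \<Rightarrow> 'a form" where
  "frame_hodge e \<omega> = (\<lambda>xs. \<Sum>I\<in>Pow {1..7}.
     (let is = sorted_list_of_set I
      in \<omega> (map e is) * frame_form e [1, 2, 3, 4, 5, 6, 7] (map e is @ xs)))"


section \<open>$\mathrm{G}_2$-structures\<close>

definition adapted_frame :: "'a::real_vector form \<Rightarrow> (nat \<Rightarrow> 'a) \<Rightarrow> bool" where
  "adapted_frame \<phi> e \<longleftrightarrow> is_frame e \<and>
     \<phi> = (\<lambda>xs. frame_form e [1, 2, 7] xs + frame_form e [3, 4, 7] xs + frame_form e [5, 6, 7] xs
              + frame_form e [1, 3, 5] xs - frame_form e [2, 4, 5] xs - frame_form e [1, 4, 6] xs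
              - frame_form e [2, 3, 6] xs)"

definition G2_structure :: "'a::real_vector form \<Rightarrow> bool" where
  "G2_structure \<phi> \<longleftrightarrow> alternating_form 3 \<phi> \<and> (\<exists>e. adapted_frame \<phi> e)"

text \<open>
  Two adapted frames differ by an element of \<open>G\<^sub>2 \<subseteq> SO(7)\<close>, so the metric and the Hodge operator
  below depend on \<open>\<phi>\<close> alone, not on the frame that is chosen.
\<close>

definition G2_frame :: "'a::real_vector form \<Rightarrow> nat \<Rightarrow> 'a" where
  "G2_frame \<phi> = (SOME e. adapted_frame \<phi> e)"

definition G2_metric :: "'a::real_vector form \<Rightarrow> 'a \<Rightarrow> 'a \<Rightarrow> real" where
  "G2_metric \<phi> x y =
     (\<Sum>i = 1..7. dual_coord (G2_frame \<phi>) i x * dual_coord (G2_frame \<phi>) i y)"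

definition G2_hodge :: "'a::real_vector form \<Rightarrow> 'a form \<Rightarrow> 'a form" where
  "G2_hodge \<phi> = frame_hodge (G2_frame \<phi>)"

definition G2_tau1 :: "('a::real_vector \<Rightarrow> 'a \<Rightarrow> 'a) \<Rightarrow> 'a form \<Rightarrow> 'a form" where
  "G2_tau1 br \<phi> = (\<lambda>xs. 1 / 12 * G2_hodge \<phi> (wedge \<phi> (G2_hodge \<phi> (ce_diff br \<phi>))) xs)"

definition G2T_structure :: "('a::real_vector \<Rightarrow> 'a \<Rightarrow> 'a) \<Rightarrow> 'a form \<Rightarrow> bool" where
  "G2T_structure br \<phi> \<longleftrightarrow> G2_structure \<phi> \<and>
     ce_diff br (G2_hodge \<phi> \<phi>) = (\<lambda>xs. 4 * wedge (G2_tau1 br \<phi>) (G2_hodge \<phi> \<phi>) xs)"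

definition coclosed :: "('a::real_vector \<Rightarrow> 'a \<Rightarrow> 'a) \<Rightarrow> 'a form \<Rightarrow> bool" where
  "coclosed br \<phi> \<longleftrightarrow> ce_diff br (G2_hodge \<phi> \<phi>) = (\<lambda>xs. 0)"

definition calibrates :: "'a::real_vector form \<Rightarrow> 'a set \<Rightarrow> bool" where
  "calibrates \<phi> W \<longleftrightarrow>
     (\<exists>z1 z2 z3. span {z1, z2, z3} = W \<and>
        G2_metric \<phi> z1 z1 = 1 \<and> G2_metric \<phi> z2 z2 = 1 \<and> G2_metric \<phi> z3 z3 = 1 \<and>
        G2_metric \<phi> z1 z2 = 0 \<and> G2_metric \<phi> z1 z3 = 0 \<and> G2_metric \<phi> z2 z3 = 0 \<and>
        \<bar>\<phi> [z1, z2, z3]\<bar> = 1)"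

end

theory Submission
  imports Defs
begin

text \<open>
  Write \<open>d\<psi> = \<theta> \<and> \<psi>\<close> with \<open>\<theta> = 4\<tau>\<^sub>1\<close>. Under either hypothesis there are linearly independent \<open>a, b\<close> with
  \<open>d\<psi>(\<cdot>, \<cdot>, \<cdot>, a, b) = 0\<close>: if \<open>\<nn>'\<close> is spanned by \<open>a\<close>, take any
  \<open>b\<close> independent of \<open>a\<close>; if it is 2-dimensional, take a basis \<open>a, b\<close>;
  if it is calibrated, take two vectors of an orthonormal basis \<open>a, b, c\<close>, because then
  \<open>c = \<plusminus> a \<times> b\<close> and \<open>\<psi>(a, b, a \<times> b, \<cdot>) = 0\<close>. In each case \<open>\<psi>([x, y], w, a, b) = 0\<close>.

  It remains to see that \<open>(\<theta> \<and> \<psi>)(\<cdot>, \<cdot>, \<cdot>, a, b) = 0\<close> forces \<open>\<theta> = 0\<close>. Let \<open>t\<close> be the vector dual to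
  \<open>\<theta>\<close>. Contracting with \<open>\<phi>\<close> gives \<open>t \<bullet> (a \<times> b) = 0\<close>, and contracting with \<open>\<psi>\<close> gives
  \<open>t \<times> (a \<times> b) = 3 ((t \<bullet> b) a - (t \<bullet> a) b)\<close>. Pairing the latter with \<open>a\<close> and \<open>b\<close> yields
  \<open>t \<bullet> a = t \<bullet> b = 0\<close>, so that \<open>t \<times> (a \<times> b) = 0\<close>, and \<open>|t|\<^sup>2 |a \<times> b|\<^sup>2 = 0\<close>.
\<close>

section \<open>Expansion of wedge products of coframe elements\<close>

abbreviation omit :: "nat \<Rightarrow> 'b list \<Rightarrow> 'b list" where
  "omit p xs \<equiv> take p xs @ drop (Suc p) xs"

lemma nths_Compl_singleton:
  "nths xs ({..<length xs} - {p}) = omit p xs"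
proof (induction xs arbitrary: p)
  case (Cons x xs)
  have *: "{j. Suc j \<in> {..<length (x # xs)} - {p}} =
      (if p = 0 then {..<length xs} else {..<length xs} - {p - 1})"
    by (cases p) auto
  have **: "nths xs {..<length xs} = xs"
    by (rule nths_all) auto
  show ?case
    unfolding nths_Cons * using Cons.IH[of "p - 1"] ** by (cases p) auto
qed simp

lemma nths_singleton: "p < length xs \<Longrightarrow> nths xs {p} = [xs ! p]"
proof (induction xs arbitrary: p)
  case (Cons x xs)
  then show ?case
  proof (cases p)
    case (Suc q)
    then have "{j. Suc j = p} = {q}" by auto
    with Cons Suc show ?thesis by (auto simp: nths_Cons)
  qed (auto simp: nths_Cons)
qed simp

text \<open>Since \<open>nths xs I\<close> has length \<open>card I\<close>, only singletons
  \<open>I = {p}\<close> reach the one-form. The argument at \<open>p\<close> jumps over the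
  \<open>p\<close> earlier ones, hence the sign \<open>(-1) ^ p\<close>.\<close>

lemma wedge_one_form:
  assumes "\<And>xs. length xs \<noteq> 1 \<Longrightarrow> \<alpha> xs = 0"
  shows "wedge \<alpha> \<beta> xs = (\<Sum>p<length xs. (-1) ^ p * \<alpha> [xs ! p] * \<beta> (omit p xs))"
proof -
  let ?n = "length xs"
  let ?f = "\<lambda>I. (-1) ^ card {(i, j). i \<in> I \<and> j \<in> {..<?n} - I \<and> j < i} *
     \<alpha> (nths xs I) * \<beta> (nths xs ({..<?n} - I))"
  have z: "?f I = 0" if "I \<in> Pow {..<?n} - (\<lambda>p. {p}) ` {..<?n}" for I
  proof -
    have "{i. i < ?n \<and> i \<in> I} = I" "finite I" using that by (auto intro: finite_subset)
    then have "length (nths xs I) = card I" by (simp add: length_nths)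
    moreover have "card I \<noteq> 1"
      using that by (auto simp: card_1_singleton_iff)
    ultimately show ?thesis using assms by simp
  qed
  have "wedge \<alpha> \<beta> xs = sum ?f ((\<lambda>p. {p}) ` {..<?n})"
    unfolding wedge_def using z by (intro sum.mono_neutral_right) auto
  also have "\<dots> = (\<Sum>p<?n. ?f {p})"
    by (subst sum.reindex) (auto simp: inj_on_def)
  also have "\<dots> = (\<Sum>p<?n. (-1) ^ p * \<alpha> [xs ! p] * \<beta> (omit p xs))"
  proof (rule sum.cong)
    fix p assume p: "p \<in> {..<?n}"
    have "{(i, j). i \<in> {p} \<and> j \<in> {..<?n} - {p} \<and> j < i} = Pair p ` {..<p}"
      using p by auto
    then have "card {(i, j). i \<in> {p} \<and> j \<in> {..<?n} - {p} \<and> j < i} = p"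
      by (simp add: card_image inj_on_def)
    with p show "?f {p} = (-1) ^ p * \<alpha> [xs ! p] * \<beta> (omit p xs)"
      by (simp add: nths_singleton nths_Compl_singleton)
  qed simp
  finally show ?thesis .
qed

text \<open>Laplace expansion of the determinant \<open>det (e^k(x))\<close> along its first
  row.\<close>

lemma frame_form_row:
  "frame_form e (k # ks) xs =
     (\<Sum>p<length xs. (-1) ^ p * dual_coord e k (xs ! p) * frame_form e ks (omit p xs))"
  unfolding frame_form.simps
  by (subst wedge_one_form) (auto simp: dual_form_def split: list.splits)

declare frame_form.simps(2)[simp del]

lemma frame_form_degree: "length xs \<noteq> length ks \<Longrightarrow> frame_form e ks xs = 0"
proof (induction ks arbitrary: xs)
  case (Cons k ks)
  then have "frame_form e ks (omit p xs) = 0" if "p < length xs" for p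
    using that by (intro Cons.IH) auto
  then show ?case by (simp add: frame_form_row)
qed simp

text \<open>Laplace expansion along the first column, which consumes the arguments one by one. It
  follows by expanding along the first row, expanding each minor along its first column by
  induction, and interchanging the two sums.\<close>

lemma frame_form_column:
  "frame_form e ks (x # xs) =
     (\<Sum>q<length ks. (-1) ^ q * dual_coord e (ks ! q) x * frame_form e (omit q ks) xs)"
proof (induction ks arbitrary: xs)
  case (Cons k ks)
  let ?c = "dual_coord e"
  have "frame_form e (k # ks) (x # xs) = ?c k x * frame_form e ks xs +
      (\<Sum>p<length xs. (-1) ^ Suc p * ?c k (xs ! p) * frame_form e ks (x # omit p xs))"
    by (simp add: frame_form_row sum.lessThan_Suc_shift del: sum.lessThan_Suc)
  also have "(\<Sum>p<length xs. (-1) ^ Suc p * ?c k (xs ! p) * frame_form e ks (x # omit p xs)) =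
      (\<Sum>p<length xs. \<Sum>q<length ks. (-1) ^ Suc q * ?c (ks ! q) x *
        ((-1) ^ p * ?c k (xs ! p) * frame_form e (omit q ks) (omit p xs)))"
    unfolding Cons.IH sum_distrib_left by (intro sum.cong) simp_all
  also have "\<dots> = (\<Sum>q<length ks. (-1) ^ Suc q * ?c (ks ! q) x * frame_form e (k # omit q ks) xs)"
    unfolding frame_form_row sum_distrib_left by (rule sum.swap)
  finally show ?case by (simp add: sum.lessThan_Suc_shift del: sum.lessThan_Suc)
qed simp

section \<open>Coordinates with respect to a frame\<close>

lemma linear_dual_coord:
  assumes "is_frame e" shows "linear (dual_coord e i)"
proof -
  have "independent (e ` {1..7})" "span (e ` {1..7}) = UNIV"
    using assms by (auto simp: is_frame_def)
  then show ?thesis unfolding dual_coord_def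
    by (intro linearI) (auto simp: representation_add representation_scale)
qed

lemma dual_coord_frame:
  assumes "is_frame e" "i \<in> {1..7}" "j \<in> {1..7}"
  shows "dual_coord e i (e j) = (if i = j then 1 else 0)"
proof -
  have "independent (e ` {1..7})" "inj_on e {1..7}"
    using assms by (auto simp: is_frame_def)
  with assms(2,3) show ?thesis unfolding dual_coord_def
    by (subst representation_basis) (auto dest: inj_onD)
qed

lemma frame_expansion:
  assumes "is_frame e" shows "x = (\<Sum>i = 1..7. dual_coord e i x *\<^sub>R e i)"
proof -
  have f: "independent (e ` {1..7})" "span (e ` {1..7}) = UNIV" "inj_on e {1..7}"
    using assms by (auto simp: is_frame_def)
  have "x = (\<Sum>b\<in>e ` {1..7}. representation (e ` {1..7}) x b *\<^sub>R b)"
    using f by (intro sum_representation_eq[symmetric]) auto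
  also have "\<dots> = (\<Sum>i = 1..7. dual_coord e i x *\<^sub>R e i)"
    using f(3) by (simp only: sum.reindex comp_def dual_coord_def)
  finally show ?thesis .
qed

lemma linear_frame_form_last:
  assumes "is_frame e" shows "linear (\<lambda>x. frame_form e ks (ys @ [x]))"
proof (induction ys arbitrary: ks)
  case Nil
  show ?case unfolding append_Nil frame_form_column
    using linear_dual_coord[OF assms]
    by (intro linear_compose_sum ballI linearI)
      (auto simp: linear_add linear_cmul algebra_simps)
next
  case (Cons y ys)
  have "linear (\<lambda>x. c * frame_form e ks' (ys @ [x]))" for c ks'
    using linear_add[OF Cons[of ks']] linear_cmul[OF Cons[of ks']]
    by (intro linearI) (simp_all add: algebra_simps)
  then show ?case unfolding append_Cons frame_form_column
    by (intro linear_compose_sum ballI)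
qed

text \<open>Turns the sum over the 128 index sets in the Hodge operator into a list sum that
  simplification can unfold. The induction splits the subsets by whether they contain the head
  \<open>k\<close>, which then comes first in the sorted list.\<close>

lemma sum_Pow_subseqs:
  fixes f :: "nat list \<Rightarrow> real"
  assumes "sorted_wrt (<) ks"
  shows "(\<Sum>I\<in>Pow (set ks). f (sorted_list_of_set I)) = (\<Sum>is\<leftarrow>subseqs ks. f is)"
  using assms
proof (induction ks arbitrary: f)
  case (Cons k ks)
  then have k: "sorted_wrt (<) ks" "k \<notin> set ks" "\<And>l. l \<in> set ks \<Longrightarrow> k < l" by auto
  have ins: "sorted_list_of_set (insert k I) = k # sorted_list_of_set I" if "I \<in> Pow (set ks)" for I
  proof -
    have I: "finite I" "k \<notin> I" "\<And>l. l \<in> I \<Longrightarrow> k < l"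
      using that k by (auto intro: finite_subset)
    then show ?thesis
      by (intro sorted_list_of_set_unique[THEN iffD1])
         (auto simp: strict_sorted_iff)
  qed
  have "(\<Sum>I\<in>Pow (set (k # ks)). f (sorted_list_of_set I)) =
      (\<Sum>I\<in>Pow (set ks). f (sorted_list_of_set I)) +
      (\<Sum>I\<in>insert k ` Pow (set ks). f (sorted_list_of_set I))"
    unfolding list.set Pow_insert using k(2) by (intro sum.union_disjoint) auto
  also have "(\<Sum>I\<in>insert k ` Pow (set ks). f (sorted_list_of_set I)) =
      (\<Sum>I\<in>Pow (set ks). f (k # sorted_list_of_set I))"
    using k(2) by (subst sum.reindex) (auto simp: inj_on_def ins)
  finally show ?case
    using Cons.IH[OF k(1), of f] Cons.IH[OF k(1), of "\<lambda>is. f (k # is)"]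
    by (simp add: Let_def comp_def)
qed simp

section \<open>Explicit expansions in degrees one to seven\<close>

lemma frame_form_1:
  "frame_form e [i] (x # xs) = dual_coord e i x * frame_form e [] xs"
  by (simp add: frame_form_column)

lemma frame_form_2:
  "frame_form e [i, j] (x # xs) = dual_coord e i x * frame_form e [j] xs - dual_coord e j x * frame_form e [i] xs"
  by (simp add: frame_form_column[of _ "_ # _"] eval_nat_numeral lessThan_Suc)

lemma frame_form_3:
  "frame_form e [i, j, k] (x # xs) = dual_coord e i x * frame_form e [j, k] xs
     - dual_coord e j x * frame_form e [i, k] xs + dual_coord e k x * frame_form e [i, j] xs"
  by (simp add: frame_form_column[of _ "_ # _"] eval_nat_numeral lessThan_Suc)

lemma frame_form_4:
  "frame_form e [i, j, k, l] (x # xs) = dual_coord e i x * frame_form e [j, k, l] xs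
     - dual_coord e j x * frame_form e [i, k, l] xs + dual_coord e k x * frame_form e [i, j, l] xs
     - dual_coord e l x * frame_form e [i, j, k] xs"
  by (simp add: frame_form_column[of _ "_ # _"] eval_nat_numeral lessThan_Suc)

lemma frame_form_5:
  "frame_form e [i, j, k, l, m] (x # xs) = dual_coord e i x * frame_form e [j, k, l, m] xs
     - dual_coord e j x * frame_form e [i, k, l, m] xs + dual_coord e k x * frame_form e [i, j, l, m] xs
     - dual_coord e l x * frame_form e [i, j, k, m] xs + dual_coord e m x * frame_form e [i, j, k, l] xs"
  by (simp add: frame_form_column[of _ "_ # _"] eval_nat_numeral lessThan_Suc)

lemma frame_form_6:
  "frame_form e [i, j, k, l, m, n] (x # xs) = dual_coord e i x * frame_form e [j, k, l, m, n] xs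
     - dual_coord e j x * frame_form e [i, k, l, m, n] xs + dual_coord e k x * frame_form e [i, j, l, m, n] xs
     - dual_coord e l x * frame_form e [i, j, k, m, n] xs + dual_coord e m x * frame_form e [i, j, k, l, n] xs
     - dual_coord e n x * frame_form e [i, j, k, l, m] xs"
  by (simp add: frame_form_column[of _ "_ # _"] eval_nat_numeral lessThan_Suc)

lemma frame_form_7:
  "frame_form e [i, j, k, l, m, n, p] (x # xs) = dual_coord e i x * frame_form e [j, k, l, m, n, p] xs
     - dual_coord e j x * frame_form e [i, k, l, m, n, p] xs + dual_coord e k x * frame_form e [i, j, l, m, n, p] xs
     - dual_coord e l x * frame_form e [i, j, k, m, n, p] xs + dual_coord e m x * frame_form e [i, j, k, l, n, p] xs
     - dual_coord e n x * frame_form e [i, j, k, l, m, p] xs + dual_coord e p x * frame_form e [i, j, k, l, m, n] xs"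
  by (simp add: frame_form_column[of _ "_ # _"] eval_nat_numeral lessThan_Suc)

lemmas frame_form_eval = frame_form_1 frame_form_2 frame_form_3 frame_form_4 frame_form_5
  frame_form_6 frame_form_7

text \<open>On a frame vector every coordinate is 0 or 1, so comparing numerals decides which minors
  survive.\<close>

lemma frame_form_basis:
  assumes "is_frame e" "a \<in> {1..7}"
  shows
    "{i} \<subseteq> {1..7} \<Longrightarrow> frame_form e [i] (e a # xs) =
       (if i = a then frame_form e [] xs else 0)"
    "{i, j} \<subseteq> {1..7} \<Longrightarrow> frame_form e [i, j] (e a # xs) =
       (if i = a then frame_form e [j] xs else 0) - (if j = a then frame_form e [i] xs else 0)"
    "{i, j, k} \<subseteq> {1..7} \<Longrightarrow> frame_form e [i, j, k] (e a # xs) =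
       (if i = a then frame_form e [j, k] xs else 0) - (if j = a then frame_form e [i, k] xs else 0)
       + (if k = a then frame_form e [i, j] xs else 0)"
    "{i, j, k, l} \<subseteq> {1..7} \<Longrightarrow> frame_form e [i, j, k, l] (e a # xs) =
       (if i = a then frame_form e [j, k, l] xs else 0) - (if j = a then frame_form e [i, k, l] xs else 0)
       + (if k = a then frame_form e [i, j, l] xs else 0) - (if l = a then frame_form e [i, j, k] xs else 0)"
    "{i, j, k, l, m} \<subseteq> {1..7} \<Longrightarrow> frame_form e [i, j, k, l, m] (e a # xs) =
       (if i = a then frame_form e [j, k, l, m] xs else 0) - (if j = a then frame_form e [i, k, l, m] xs else 0)
       + (if k = a then frame_form e [i, j, l, m] xs else 0) - (if l = a then frame_form e [i, j, k, m] xs else 0)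
       + (if m = a then frame_form e [i, j, k, l] xs else 0)"
    "{i, j, k, l, m, n} \<subseteq> {1..7} \<Longrightarrow> frame_form e [i, j, k, l, m, n] (e a # xs) =
       (if i = a then frame_form e [j, k, l, m, n] xs else 0) - (if j = a then frame_form e [i, k, l, m, n] xs else 0)
       + (if k = a then frame_form e [i, j, l, m, n] xs else 0) - (if l = a then frame_form e [i, j, k, m, n] xs else 0)
       + (if m = a then frame_form e [i, j, k, l, n] xs else 0) - (if n = a then frame_form e [i, j, k, l, m] xs else 0)"
    "{i, j, k, l, m, n, p} \<subseteq> {1..7} \<Longrightarrow> frame_form e [i, j, k, l, m, n, p] (e a # xs) =
       (if i = a then frame_form e [j, k, l, m, n, p] xs else 0) - (if j = a then frame_form e [i, k, l, m, n, p] xs else 0)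
       + (if k = a then frame_form e [i, j, l, m, n, p] xs else 0) - (if l = a then frame_form e [i, j, k, m, n, p] xs else 0)
       + (if m = a then frame_form e [i, j, k, l, n, p] xs else 0) - (if n = a then frame_form e [i, j, k, l, m, p] xs else 0)
       + (if p = a then frame_form e [i, j, k, l, m, n] xs else 0)"
  using assms by (simp_all add: frame_form_eval dual_coord_frame)

section \<open>The dual 4-form psi in an adapted frame\<close>

definition coassociative_form :: "(nat \<Rightarrow> 'a::real_vector) \<Rightarrow> 'a form" where
  "coassociative_form e = (\<lambda>xs. frame_form e [3, 4, 5, 6] xs - frame_form e [2, 4, 6, 7] xs
     + frame_form e [2, 3, 5, 7] xs + frame_form e [1, 4, 5, 7] xs + frame_form e [1, 3, 6, 7] xs
     + frame_form e [1, 2, 5, 6] xs + frame_form e [1, 2, 3, 4] xs)"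

lemma frame_hodge_adapted:
  assumes "adapted_frame \<phi> e"
  shows "frame_hodge e \<phi> = coassociative_form e"
proof
  fix xs
  have fr: "is_frame e" and phi: "\<phi> = (\<lambda>xs. frame_form e [1, 2, 7] xs + frame_form e [3, 4, 7] xs + frame_form e [5, 6, 7] xs
              + frame_form e [1, 3, 5] xs - frame_form e [2, 4, 5] xs - frame_form e [1, 4, 6] xs
              - frame_form e [2, 3, 6] xs)" using assms by (auto simp: adapted_frame_def)
  have "frame_hodge e \<phi> xs = (\<Sum>I\<in>Pow (set [1, 2, 3, 4, 5, 6, 7]).
     (\<lambda>is. \<phi> (map e is) * frame_form e [1, 2, 3, 4, 5, 6, 7] (map e is @ xs)) (sorted_list_of_set I))"
  proof -
    have "{1..7} = set [1, 2, 3, 4, 5, 6, 7::nat]" by auto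
    then show ?thesis unfolding frame_hodge_def Let_def by simp
  qed
  also have "\<dots> = (\<Sum>is\<leftarrow>subseqs [1, 2, 3, 4, 5, 6, 7].
      \<phi> (map e is) * frame_form e [1, 2, 3, 4, 5, 6, 7] (map e is @ xs))"
    by (rule sum_Pow_subseqs) simp
  \<comment> \<open>Only the seven index sets occurring in \<open>\<phi>\<close> have a nonzero
    coefficient. Each contributes the complementary 4-form with the sign of the shuffle.\<close>
  also have "\<dots> = coassociative_form e xs"
    by (simp add: coassociative_form_def phi Let_def frame_form_degree frame_form_basis[OF fr])
  finally show "frame_hodge e \<phi> xs = coassociative_form e xs" .
qed

section \<open>The cross product\<close>

text \<open>The sum is written out so that the identities for the cross product become polynomial
  identities in explicit variables.\<close>

definition dot7 :: "(nat \<Rightarrow> real) \<Rightarrow> (nat \<Rightarrow> real) \<Rightarrow> real" where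
  "dot7 u v = u 1 * v 1 + u 2 * v 2 + u 3 * v 3 + u 4 * v 4 + u 5 * v 5 + u 6 * v 6 + u 7 * v 7"

text \<open>The components of \<open>u \<times> v\<close>, defined by \<open>(u \<times> v) \<bullet> w = \<phi>(u, v, w)\<close>.\<close>

definition cross7 :: "(nat \<Rightarrow> real) \<Rightarrow> (nat \<Rightarrow> real) \<Rightarrow> nat \<Rightarrow> real" where
  "cross7 u v = (let m = \<lambda>i j. u i * v j - u j * v i in (\<lambda>_. 0)
     (1 := m 2 7 + m 3 5 - m 4 6,
      2 := m 7 1 - m 4 5 - m 3 6,
      3 := m 4 7 + m 5 1 - m 6 2,
      4 := m 7 3 - m 5 2 - m 6 1,
      5 := m 6 7 + m 1 3 - m 2 4,
      6 := m 7 5 - m 1 4 - m 2 3,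
      7 := m 1 2 + m 3 4 + m 5 6))"

lemma index_cases_7:
  "(k::nat) \<in> {1..7} \<longleftrightarrow> k = 1 \<or> k = 2 \<or> k = 3 \<or> k = 4 \<or> k = 5 \<or> k = 6 \<or> k = 7"
  by auto

lemma dot7_commute: "dot7 u v = dot7 v u"
  by (simp add: dot7_def algebra_simps)

lemma dot7_self_eq_0: "dot7 u u = 0 \<Longrightarrow> k \<in> {1..7} \<Longrightarrow> u k = 0"
  unfolding dot7_def index_cases_7
  by (smt (verit) mult_eq_0_iff zero_le_square)

text \<open>The Lagrange identity, reflecting that the norm of the octonions is
  multiplicative.\<close>

lemma cross7_norm: "dot7 (cross7 u v) (cross7 u v) = dot7 u u * dot7 v v - (dot7 u v)\<^sup>2"
  by (simp add: dot7_def cross7_def Let_def power2_eq_square algebra_simps)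

lemma cross7_cross7:
  "k \<in> {1..7} \<Longrightarrow> cross7 (cross7 u v) u k = dot7 u u * v k - dot7 u v * u k"
  unfolding index_cases_7
  by (elim disjE) (simp_all add: dot7_def cross7_def Let_def algebra_simps)

lemma dot7_cross7: "dot7 (cross7 u v) w = dot7 u (cross7 v w)"
  by (simp add: dot7_def cross7_def Let_def algebra_simps)

text \<open>Skew symmetry of \<open>\<phi>\<close> moves the outer product to the other side of the
  pairing, where \<open>cross7_cross7\<close> applies.\<close>

lemma dot7_cross7_cross7:
  "dot7 (cross7 t (cross7 u v)) u = dot7 u u * dot7 t v - dot7 u v * dot7 t u"
proof -
  have "dot7 (cross7 t (cross7 u v)) u = dot7 t (\<lambda>k. dot7 u u * v k - dot7 u v * u k)"
    unfolding dot7_cross7 by (simp add: dot7_def[of t] cross7_cross7)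
  then show ?thesis by (simp add: dot7_def[of t] algebra_simps)
qed

lemma cross7_contraction_trivial:
  assumes P: "dot7 a a * dot7 b b - (dot7 a b)\<^sup>2 \<noteq> 0"
    and t: "dot7 t (cross7 a b) = 0"
    and eq: "\<And>k. k \<in> {1..7} \<Longrightarrow> cross7 t (cross7 a b) k = 3 * (dot7 t b * a k - dot7 t a * b k)"
    and k: "k \<in> {1..7}"
  shows "t k = 0"
proof -
  let ?c = "cross7 a b"
  define A B G S T where defs: "A = dot7 a a" "B = dot7 b b" "G = dot7 a b" "S = dot7 t a" "T = dot7 t b"
  have 1: "dot7 (cross7 t ?c) w = 3 * (T * dot7 a w - S * dot7 b w)" for w
    by (simp add: dot7_def[of "cross7 _ _"] eq dot7_def[of a w] dot7_def[of b w] defs(4,5) algebra_simps)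
  \<comment> \<open>Pairing with \<open>a\<close> gives this expression by
    \<open>dot7_cross7_cross7\<close>, but three times it by the hypothesis, so it is zero. Pairing
    with \<open>b\<close> works in the same way after exchanging \<open>a\<close> and
    \<open>b\<close>.\<close>
  have X: "A * T - G * S = 0"
    using 1[of a] dot7_cross7_cross7[of t a b] by (simp add: defs dot7_commute[of b a])
  have "dot7 (cross7 t ?c) b = - dot7 (cross7 t (cross7 b a)) b"
    by (simp add: dot7_def cross7_def Let_def algebra_simps)
  then have Y: "B * S - G * T = 0"
    using 1[of b] dot7_cross7_cross7[of t b a] by (simp add: defs dot7_commute[of b a])
  \<comment> \<open>Cramer's rule: \<open>X\<close> and \<open>Y\<close> form a homogeneous linear
    system for \<open>S\<close> and \<open>T\<close> whose determinant is, up to sign, the Gram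
    determinant of \<open>a\<close> and \<open>b\<close>.\<close>
  have "(A * B - G\<^sup>2) * S = A * (B * S - G * T) + G * (A * T - G * S)"
    "(A * B - G\<^sup>2) * T = B * (A * T - G * S) + G * (B * S - G * T)"
    by (simp_all add: power2_eq_square algebra_simps)
  then have "S = 0" "T = 0" using X Y P by (auto simp: defs)
  \<comment> \<open>Fact \<open>1\<close> is applied with \<open>t \<times> (a \<times> b)\<close>
    itself as \<open>w\<close>. The Lagrange identity is then used twice, for this product and for
    \<open>a \<times> b\<close>.\<close>
  then have "dot7 (cross7 t ?c) (cross7 t ?c) = 0"
    using 1 by simp
  then have "dot7 t t * (A * B - G\<^sup>2) = 0"
    by (simp add: cross7_norm t defs)
  then have "dot7 t t = 0" using P by (simp add: defs)
  then show ?thesis using k by (rule dot7_self_eq_0)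
qed

section \<open>The forms phi and psi in terms of the cross product\<close>

abbreviation coords :: "(nat \<Rightarrow> 'a::real_vector) \<Rightarrow> 'a \<Rightarrow> nat \<Rightarrow> real" where
  "coords e x \<equiv> \<lambda>i. dual_coord e i x"

lemma one_form_coords:
  assumes "is_frame e" "linear f"
  shows "f x = dot7 (\<lambda>i. f (e i)) (coords e x)"
proof -
  have *: "{1..7} = {1, 2, 3, 4, 5, 6, 7::nat}" by auto
  have "f x = (\<Sum>i = 1..7. dual_coord e i x * f (e i))"
    by (subst frame_expansion[OF assms(1), of x])
      (simp add: linear_sum[OF assms(2)] linear_cmul[OF assms(2)])
  then show ?thesis unfolding * by (simp add: dot7_def algebra_simps)
qed

lemma linear_coassociative_form_last:
  assumes "is_frame e" shows "linear (\<lambda>w. coassociative_form e [x, y, z, w])"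
  unfolding coassociative_form_def
  using linear_frame_form_last[OF assms, of _ "[x, y, z]"]
  by (intro linear_compose_add linear_compose_sub) simp_all

text \<open>Up to a constant factor psi is the octonion associator paired with its last argument,
  and \<open>x\<close>, \<open>y\<close>, \<open>x \<times> y\<close> lie in an associative
  subalgebra by Artin's theorem. The proof checks this on the seven frame vectors; the factor
  \<open>s\<close> admits both orientations of a calibrated triple.\<close>

lemma coassociative_form_cross7:
  assumes fr: "is_frame e"
    and z: "\<And>k. k \<in> {1..7} \<Longrightarrow> dual_coord e k z = s * cross7 (coords e x) (coords e y) k"
  shows "coassociative_form e [z, x, y, w] = 0"
proof -
  let ?F = "\<lambda>l. coassociative_form e [z, x, y, e l]"
  have "?F 1 = 0" "?F 2 = 0" "?F 3 = 0" "?F 4 = 0" "?F 5 = 0" "?F 6 = 0" "?F 7 = 0"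
    unfolding coassociative_form_def
    by (simp_all add: frame_form_eval dual_coord_frame[OF fr] z, simp_all add: cross7_def Let_def, algebra+)
  then show ?thesis
    by (subst one_form_coords[OF fr linear_coassociative_form_last[OF fr]]) (simp add: dot7_def)
qed

lemma G2_form_cross7:
  assumes "adapted_frame \<phi> e"
  shows "\<phi> [x, y, z] = dot7 (cross7 (coords e x) (coords e y)) (coords e z)"
  using assms unfolding adapted_frame_def
  by (simp add: frame_form_eval) (simp add: dot7_def cross7_def Let_def algebra_simps)

text \<open>This is the equality case of Cauchy-Schwarz: \<open>z\<close> and
  \<open>x \<times> y\<close> are unit vectors with inner product \<open>s = \<plusminus>1\<close>,
  so \<open>|z - s (x \<times> y)|^2 = 1 - 2 s^2 + s^2 = 0\<close>.\<close>

lemma calibrated_triple: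
  assumes "adapted_frame \<phi> e"
    and "dot7 (coords e x) (coords e x) = 1" "dot7 (coords e y) (coords e y) = 1"
      "dot7 (coords e z) (coords e z) = 1" "dot7 (coords e x) (coords e y) = 0"
    and "\<bar>\<phi> [x, y, z]\<bar> = 1"
  shows "coassociative_form e [z, x, y, w] = 0"
proof -
  define c s where "c = cross7 (coords e x) (coords e y)" and "s = \<phi> [x, y, z]"
  have "dot7 c c = 1" by (simp add: c_def cross7_norm assms)
  moreover have "dot7 c (coords e z) = s"
    by (simp add: c_def s_def G2_form_cross7[OF assms(1)])
  moreover have "s * s = 1" using assms(6) by (auto simp: s_def abs_if split: if_splits)
  moreover have "dot7 (\<lambda>k. dual_coord e k z - s * c k) (\<lambda>k. dual_coord e k z - s * c k) =
      dot7 (coords e z) (coords e z) - 2 * s * dot7 c (coords e z) + s * s * dot7 c c"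
    by (simp add: dot7_def algebra_simps)
  ultimately have "dot7 (\<lambda>k. dual_coord e k z - s * c k) (\<lambda>k. dual_coord e k z - s * c k) = 0"
    using assms(4) by simp
  then have "dual_coord e k z = s * c k" if "k \<in> {1..7}" for k
    using dot7_self_eq_0 that by fastforce
  then show ?thesis unfolding c_def using assms(1)
    by (intro coassociative_form_cross7) (auto simp: adapted_frame_def)
qed

text \<open>Wedging with psi stays injective on one-forms even after contraction with two
  independent vectors. The contracted 3-form has components \<open>E i j k\<close>; fixed linear
  combinations of them yield the hypotheses of \<open>cross7_contraction_trivial\<close>.\<close>

lemma wedge_coassociative_form_trivial:
  assumes fr: "is_frame e"
    and deg: "\<And>xs. length xs \<noteq> 1 \<Longrightarrow> \<theta> xs = 0"
    and lin: "linear (\<lambda>x. \<theta> [x])"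
    and P: "dot7 (coords e a) (coords e a) * dot7 (coords e b) (coords e b)
        - (dot7 (coords e a) (coords e b))\<^sup>2 \<noteq> 0"
    and E0: "\<And>x y w. wedge \<theta> (coassociative_form e) [x, y, w, a, b] = 0"
  shows "\<theta> = (\<lambda>xs. 0)"
proof -
  define t where "t = (\<lambda>i. \<theta> [e i])"
  define E where "E i j k = wedge \<theta> (coassociative_form e) [e i, e j, e k, a, b]" for i j k
  let ?a = "coords e a" and ?b = "coords e b"
  let ?c = "cross7 ?a ?b"
  have th: "\<theta> [x] = dot7 t (coords e x)" for x
    unfolding t_def by (rule one_form_coords[OF fr lin])
  have w: "wedge \<theta> \<psi> [x1, x2, x3, x4, x5] = \<theta> [x1] * \<psi> [x2, x3, x4, x5] - \<theta> [x2] * \<psi> [x1, x3, x4, x5]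
      + \<theta> [x3] * \<psi> [x1, x2, x4, x5] - \<theta> [x4] * \<psi> [x1, x2, x3, x5] + \<theta> [x5] * \<psi> [x1, x2, x3, x4]"
    for \<psi> x1 x2 x3 x4 x5
    by (subst wedge_one_form[OF deg]) (simp_all add: eval_nat_numeral lessThan_Suc)
  have te: "\<theta> [e i] = t i" for i by (simp add: t_def)
  \<comment> \<open>The contraction of \<open>E\<close> with \<open>\<phi>\<close>.\<close>
  have "E 1 2 7 + E 3 4 7 + E 5 6 7 + E 1 3 5 - E 2 4 5 - E 1 4 6 - E 2 3 6 = 2 * dot7 t ?c"
    unfolding E_def w te coassociative_form_def
    \<comment> \<open>The frame vectors are contracted first; expanding \<open>a\<close> and
      \<open>b\<close> in coordinates then leaves a polynomial identity.\<close>
    by (simp add: frame_form_basis[OF fr] del: One_nat_def,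
        simp add: frame_form_eval th dot7_def cross7_def Let_def del: One_nat_def, algebra)
  then have phi: "dot7 t ?c = 0" by (simp add: E_def E0)
  \<comment> \<open>The contractions of \<open>E\<close> with \<open>\<psi>(e\<^sub>m, \<cdot>, \<cdot>, \<cdot>)\<close> for \<open>m = 1, \<dots>, 7\<close>.\<close>
  let ?W = "\<lambda>k. cross7 t ?c k - 3 * (dot7 t ?b * ?a k - dot7 t ?a * ?b k)"
  have
    "E 2 3 4 + E 2 5 6 + E 3 6 7 + E 4 5 7 = ?W 1"
    "- E 1 3 4 - E 1 5 6 + E 3 5 7 - E 4 6 7 = ?W 2"
    "E 1 2 4 - E 1 6 7 - E 2 5 7 + E 4 5 6 = ?W 3"
    "- E 1 2 3 - E 1 5 7 + E 2 6 7 - E 3 5 6 = ?W 4"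
    "E 1 2 6 + E 1 4 7 + E 2 3 7 + E 3 4 6 = ?W 5"
    "- E 1 2 5 + E 1 3 7 - E 2 4 7 - E 3 4 5 = ?W 6"
    "- E 1 3 6 - E 1 4 5 - E 2 3 5 + E 2 4 6 = ?W 7"
    unfolding E_def w te coassociative_form_def
    by (simp_all add: frame_form_basis[OF fr] del: One_nat_def,
        simp_all add: frame_form_eval th dot7_def cross7_def Let_def del: One_nat_def, algebra+)
  then have psi: "?W k = 0" if "k \<in> {1..7}" for k
    using that unfolding index_cases_7 by (auto simp: E_def E0)
  have "t k = 0" if "k \<in> {1..7}" for k
    using cross7_contraction_trivial[OF P phi _ that] psi by simp
  then have "\<theta> [x] = 0" for x
    by (simp add: th dot7_def)
  then show ?thesis using deg
    by (auto simp: fun_eq_iff length_Suc_conv) (metis length_Suc_conv length_0_conv One_nat_def)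
qed

section \<open>Degrees and linearity\<close>

abbreviation homogeneous :: "nat \<Rightarrow> 'a form \<Rightarrow> bool" where
  "homogeneous k \<omega> \<equiv> \<forall>xs. length xs \<noteq> k \<longrightarrow> \<omega> xs = 0"

lemma homogeneous_wedge:
  assumes "homogeneous k \<alpha>" "homogeneous l \<beta>"
  shows "homogeneous (k + l) (wedge \<alpha> \<beta>)"
proof (intro allI impI)
  fix xs :: "'a list" assume xs: "length xs \<noteq> k + l"
  have "\<alpha> (nths xs I) * \<beta> (nths xs ({..<length xs} - I)) = 0" if I: "I \<in> Pow {..<length xs}" for I
  proof -
    have "{i. i < length xs \<and> i \<in> I} = I" "finite I"
      and eq: "{i. i < length xs \<and> i \<in> {..<length xs} - I} = {..<length xs} - I"
      using I by (auto intro: finite_subset)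
    then have "length (nths xs I) + length (nths xs ({..<length xs} - I)) = length xs"
      using I unfolding length_nths eq by (simp add: card_Diff_subset card_mono[of "{..<length xs}", simplified])
    then show ?thesis using assms xs by (metis mult_eq_0_iff)
  qed
  then show "wedge \<alpha> \<beta> xs = 0"
    unfolding wedge_def by (intro sum.neutral) (simp add: mult.assoc)
qed

lemma homogeneous_ce_diff:
  assumes "homogeneous k \<omega>" shows "homogeneous (Suc k) (ce_diff br \<omega>)"
proof (intro allI impI)
  fix xs :: "'a list" assume xs: "length xs \<noteq> Suc k"
  have "\<omega> (br (xs ! i) (xs ! j) # nths xs (- {i, j})) = 0" if "i < j" "j < length xs" for i j
  proof -
    have "{l. l < length xs \<and> l \<in> - {i, j}} = {..<length xs} - {i, j}" by auto
    then have "length (nths xs (- {i, j})) = length xs - 2"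
      using that by (simp add: length_nths card_Diff_subset)
    then show ?thesis using assms xs that by auto
  qed
  then show "ce_diff br \<omega> xs = 0" unfolding ce_diff_def by (intro sum.neutral) auto
qed

lemma homogeneous_frame_hodge:
  assumes "homogeneous k \<omega>" "k + l = 7" shows "homogeneous l (frame_hodge e \<omega>)"
proof (intro allI impI)
  fix xs :: "'a list" assume xs: "length xs \<noteq> l"
  have "\<omega> (map e is) * frame_form e [1, 2, 3, 4, 5, 6, 7] (map e is @ xs) = 0" for "is"
  proof (cases "length is = k")
    case True
    then have "frame_form e [1, 2, 3, 4, 5, 6, 7] (map e is @ xs) = 0"
      using xs assms(2) by (intro frame_form_degree) simp
    then show ?thesis by simp
  next
    case False then show ?thesis using assms(1) by simp
  qed
  then show "frame_hodge e \<omega> xs = 0"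
    unfolding frame_hodge_def Let_def by (intro sum.neutral ballI)
qed

text \<open>The argument \<open>x\<close> enters only through the last slot of the volume form, so
  \<open>\<omega>\<close> can be arbitrary.\<close>

lemma linear_frame_hodge:
  assumes "is_frame e" shows "linear (\<lambda>x. frame_hodge e \<omega> [x])"
proof -
  have "linear (\<lambda>x. c * frame_form e ks (ys @ [x]))" for c ks ys
    using linear_add[OF linear_frame_form_last[OF assms]] linear_cmul[OF linear_frame_form_last[OF assms]]
    by (intro linearI) (simp_all add: algebra_simps)
  then show ?thesis unfolding frame_hodge_def Let_def by (intro linear_compose_sum ballI)
qed

text \<open>The ten pairs of positions are sorted by whether the bracket absorbs neither of
  \<open>a\<close>, \<open>b\<close> (three pairs), just \<open>a\<close> (three), just
  \<open>b\<close> (three), or both (one).\<close>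

lemma ce_diff_5_eq_0:
  assumes "\<And>x y w. \<omega> [br x y, w, a, b] = 0" "\<And>x u v. \<omega> [br x a, u, v, b] = 0"
    "\<And>x u v. \<omega> [br x b, u, v, a] = 0" "\<And>u v w. \<omega> [br a b, u, v, w] = 0"
  shows "ce_diff br \<omega> [x, y, w, a, b] = 0"
proof -
  have "\<omega> (br ([x, y, w, a, b] ! i) ([x, y, w, a, b] ! j) # nths [x, y, w, a, b] (- {i, j})) = 0"
    if "i < j" "j < 5" for i j
  proof -
    have "i = 0 \<or> i = 1 \<or> i = 2 \<or> i = 3" "j = 1 \<or> j = 2 \<or> j = 3 \<or> j = 4"
      using that by presburger+
    then show ?thesis using that assms by (elim disjE) (simp_all add: nths_Cons)
  qed
  then show ?thesis unfolding ce_diff_def by (intro sum.neutral) auto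
qed

lemma lie_bracket_skew:
  assumes "lie_bracket br" shows "br x y = - br y x"
proof -
  have bil: "bilinear br" and alt: "\<And>x. br x x = 0" using assms by (auto simp: lie_bracket_def)
  have "br (x + y) (x + y) = br x x + br x y + (br y x + br y y)"
    using bil by (simp only: bilinear_ladd bilinear_radd)
  then show ?thesis by (simp add: alt eq_neg_iff_add_eq_0)
qed

lemma coassociative_form_repeat:
  "coassociative_form e [a, w, a, b] = 0" "coassociative_form e [b, w, a, b] = 0"
  "coassociative_form e [a, u, v, a] = 0"
  by (simp_all only: coassociative_form_def frame_form_eval frame_form.simps(1) simp_thms if_True mult_1_right, algebra+)

text \<open>A cyclic permutation of three slots is even. This brings the terms of the differential
  into the shape of \<open>calibrated_triple\<close>.\<close>

lemma coassociative_form_rotate: "coassociative_form e [z, w, x, y] = coassociative_form e [z, x, y, w]"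
  by (simp only: coassociative_form_def frame_form_eval frame_form.simps(1) simp_thms if_True mult_1_right, algebra)

lemma linear_coassociative_form_first:
  assumes "is_frame e" shows "linear (\<lambda>z. coassociative_form e [z, x, y, w])"
proof -
  have "linear (\<lambda>z. frame_form e ks [z, x, y, w])" for ks
    unfolding frame_form_column[of _ ks] using linear_dual_coord[OF assms]
    by (intro linear_compose_sum ballI linearI)
      (auto simp: linear_add linear_cmul algebra_simps)
  then show ?thesis unfolding coassociative_form_def
    by (intro linear_compose_add linear_compose_sub)
qed

section \<open>Gram determinants and linear independence\<close>

lemma Gram_eq_0:
  assumes fr: "is_frame e"
    and P: "dot7 (coords e a) (coords e a) * dot7 (coords e b) (coords e b)
        - (dot7 (coords e a) (coords e b))\<^sup>2 = 0"
  shows "a = 0 \<or> (\<exists>r. b = r *\<^sub>R a)"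
proof -
  have eq0: "x = 0" if "dot7 (coords e x) (coords e x) = 0" for x
    using dot7_self_eq_0[OF that] by (subst frame_expansion[OF fr]) simp
  define A G where "A = dot7 (coords e a) (coords e a)" and "G = dot7 (coords e a) (coords e b)"
  \<comment> \<open>Up to the factor \<open>A\<close>, this is the component of \<open>b\<close>
    orthogonal to \<open>a\<close>; its squared norm is \<open>A\<close> times the Gram
    determinant.\<close>
  define v where "v = A *\<^sub>R b - G *\<^sub>R a"
  have v: "coords e v k = A * coords e b k - G * coords e a k" for k
    using linear_dual_coord[OF fr] by (simp add: v_def linear_diff linear_cmul)
  have "dot7 (coords e v) (coords e v) = A\<^sup>2 * dot7 (coords e b) (coords e b)
      - 2 * A * G * dot7 (coords e a) (coords e b) + G\<^sup>2 * dot7 (coords e a) (coords e a)"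
    unfolding dot7_def v by algebra
  also have "\<dots> = A * (A * dot7 (coords e b) (coords e b) - G\<^sup>2)"
    unfolding A_def[symmetric] G_def[symmetric] by algebra
  finally have "dot7 (coords e v) (coords e v) = A * (A * dot7 (coords e b) (coords e b) - G\<^sup>2)" .
  then have "v = 0" using P by (intro eq0) (simp add: A_def G_def)
  show ?thesis
  proof (cases "A = 0")
    case True then show ?thesis using eq0 by (simp add: A_def)
  next
    case False
    have "b = (1 / A) *\<^sub>R (A *\<^sub>R b)" using False by simp
    also have "A *\<^sub>R b = G *\<^sub>R a" using \<open>v = 0\<close> by (simp add: v_def)
    finally have "b = (G / A) *\<^sub>R a" by simp
    then show ?thesis by blast
  qed
qed

lemma Gram_complement:
  assumes fr: "is_frame e" and "a \<noteq> 0"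
  obtains b where "dot7 (coords e a) (coords e a) * dot7 (coords e b) (coords e b)
        - (dot7 (coords e a) (coords e b))\<^sup>2 \<noteq> 0"
proof -
  \<comment> \<open>One of \<open>e 1\<close>, \<open>e 2\<close> can serve as \<open>b\<close>,
    because two independent vectors cannot both be multiples of \<open>a\<close>.\<close>
  have "\<not> ((\<exists>r. e 1 = r *\<^sub>R a) \<and> (\<exists>s. e 2 = s *\<^sub>R a))"
  proof safe
    fix r s assume 1: "e 1 = r *\<^sub>R a" and 2: "e 2 = s *\<^sub>R a"
    have c: "dual_coord e i (q *\<^sub>R a) = q * dual_coord e i a" for i q
      using linear_dual_coord[OF fr] by (simp add: linear_cmul)
    have "r * dual_coord e 1 a = 1" "s * dual_coord e 1 a = 0" "s * dual_coord e 2 a = 1"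
      using dual_coord_frame[OF fr, of 1 1] dual_coord_frame[OF fr, of 1 2] dual_coord_frame[OF fr, of 2 2]
      unfolding 1 2 c by simp_all
    then show False by auto
  qed
  then show ?thesis using Gram_eq_0[OF fr] that \<open>a \<noteq> 0\<close> by blast
qed

lemma G2_metric_eq: "G2_metric \<phi> x y = dot7 (coords (G2_frame \<phi>) x) (coords (G2_frame \<phi>) y)"
proof -
  have *: "{1..7} = {1, 2, 3, 4, 5, 6, 7::nat}" by auto
  show ?thesis unfolding G2_metric_def * by (simp add: dot7_def)
qed

text \<open>Reduces the theorem to exhibiting independent \<open>a\<close>, \<open>b\<close> that
  annihilate the last two slots of d psi.\<close>

lemma coclosed_if_degenerate_pair:
  fixes br :: "'a::real_vector \<Rightarrow> 'a \<Rightarrow> 'a"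
  assumes G2T: "G2T_structure br \<phi>" and e: "e = G2_frame \<phi>"
    and P: "dot7 (coords e a) (coords e a) * dot7 (coords e b) (coords e b)
        - (dot7 (coords e a) (coords e b))\<^sup>2 \<noteq> 0"
    and d: "\<And>x y w. ce_diff br (coassociative_form e) [x, y, w, a, b] = 0"
  shows "coclosed br \<phi>"
proof -
  have ad: "adapted_frame \<phi> e"
    using G2T unfolding G2T_structure_def G2_structure_def e G2_frame_def by (metis someI_ex)
  then have fr: "is_frame e" by (simp add: adapted_frame_def)
  have psi: "G2_hodge \<phi> \<phi> = coassociative_form e"
    unfolding G2_hodge_def e[symmetric] by (rule frame_hodge_adapted[OF ad])
  \<comment> \<open>Here the one-form is tau_1 itself, and the factor 4 stays outside the wedge
    product.\<close>
  let ?\<theta> = "G2_tau1 br \<phi>"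
  have dpsi: "ce_diff br (coassociative_form e) = (\<lambda>xs. 4 * wedge ?\<theta> (coassociative_form e) xs)"
    using G2T by (simp add: G2T_structure_def psi)
  \<comment> \<open>The degrees along the definition of tau_1: 3 for phi, 4 for d phi, 3 for its
    dual, 6 after wedging with phi, and finally 1.\<close>
  have "homogeneous 3 \<phi>"
    using G2T by (simp add: G2T_structure_def G2_structure_def alternating_form_def)
  then have "homogeneous 3 (frame_hodge e (ce_diff br \<phi>))"
    by (intro homogeneous_frame_hodge[where k = 4] homogeneous_ce_diff[where k = 3, simplified]) simp_all
  with \<open>homogeneous 3 \<phi>\<close> have "homogeneous 6 (wedge \<phi> (frame_hodge e (ce_diff br \<phi>)))"
    using homogeneous_wedge[of 3 \<phi> 3] by simp
  then have "homogeneous 1 (frame_hodge e (wedge \<phi> (frame_hodge e (ce_diff br \<phi>))))"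
    by (intro homogeneous_frame_hodge[where k = 6]) simp_all
  then have deg: "?\<theta> xs = 0" if "length xs \<noteq> 1" for xs
    using that unfolding G2_tau1_def G2_hodge_def e[symmetric] by simp
  have lin: "linear (\<lambda>x. ?\<theta> [x])"
    unfolding G2_tau1_def G2_hodge_def e[symmetric]
    using linear_compose_scale_right[OF linear_frame_hodge[OF fr], where c = "1 / 12"] by simp
  have "wedge ?\<theta> (coassociative_form e) [x, y, w, a, b] = 0" for x y w
    using d[of x y w] unfolding dpsi by simp
  then have "?\<theta> = (\<lambda>xs. 0)"
    by (intro wedge_coassociative_form_trivial[OF fr deg lin P])
  then show ?thesis unfolding coclosed_def psi dpsi by (simp add: wedge_def)
qed

section \<open>Choice of the pair a, b for each kind of derived algebra\<close>

theorem proposition1p1: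
  fixes br :: "'a::real_vector \<Rightarrow> 'a \<Rightarrow> 'a"
    and \<phi> :: "'a form"
  assumes "dim (UNIV :: 'a set) = 7"
    and "lie_bracket br"
    and "two_step_nilpotent br"
    and "G2T_structure br \<phi>"
    and "dim (derived_algebra br) \<le> 2 \<or>
         (dim (derived_algebra br) = 3 \<and> calibrates \<phi> (derived_algebra br))"
  shows "coclosed br \<phi>"
proof -
  define e where "e = G2_frame \<phi>"
  let ?\<psi> = "coassociative_form e" and ?D = "derived_algebra br"
  have ad: "adapted_frame \<phi> e"
    using assms(4) unfolding G2T_structure_def G2_structure_def e_def G2_frame_def by (metis someI_ex)
  then have fr: "is_frame e" by (simp add: adapted_frame_def)
  have brD: "br x y \<in> ?D" for x y
    unfolding derived_algebra_def by (rule span_base) auto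
  have central: "br x z = 0" "br z x = 0" if "z \<in> ?D" for x z
    using assms(3) that lie_bracket_skew[OF assms(2), of x z]
    by (auto simp: two_step_nilpotent_def lie_center_def)
  note lin = linear_coassociative_form_first[OF fr]
  note [simp] = linear_0[OF lin] linear_add[OF lin] linear_cmul[OF lin] coassociative_form_repeat
  note coclosedI = coclosed_if_degenerate_pair[OF assms(4) e_def]
  from assms(5) show ?thesis
  proof
    assume "dim ?D \<le> 2"
    obtain B where B: "B \<subseteq> ?D" "independent B" "?D \<subseteq> span B" "card B = dim ?D"
      using basis_exists by blast
    \<comment> \<open>The type is an arbitrary real vector space, so finiteness comes from the seven
      spanning frame vectors. It rules out the default value 0 of \<open>card\<close> on infinite
      sets.\<close>
    have "finite B"
      using independent_span_bound[of "e ` {1..7}" B] B(2) fr by (auto simp: is_frame_def)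
    moreover have "B \<noteq> {}"
      using B assms(3) brD[of 0 0] by (auto simp: two_step_nilpotent_def)
    ultimately consider "card B = 1" | "card B = 2"
      using B(4) \<open>dim ?D \<le> 2\<close> by (metis card_gt_0_iff One_nat_def Suc_1 le_Suc_eq le_zero_eq less_irrefl)
    then show ?thesis
    proof cases
      case 1
      then obtain a where a: "B = {a}" by (auto simp: card_1_singleton_iff)
      then have "a \<noteq> 0" "a \<in> ?D" using B by auto
      have "br x y \<in> span {a}" for x y using brD B a by blast
      then have r: "\<exists>r. br x y = r *\<^sub>R a" for x y by (auto simp: span_singleton)
      \<comment> \<open>This \<open>b\<close> may fail to be central, but \<open>[x, b]\<close> is a
        multiple of \<open>a\<close>, so psi vanishes on it once \<open>a\<close> fills another
        slot.\<close>
      obtain b where P: "dot7 (coords e a) (coords e a) * dot7 (coords e b) (coords e b)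
          - (dot7 (coords e a) (coords e b))\<^sup>2 \<noteq> 0"
        using Gram_complement[OF fr \<open>a \<noteq> 0\<close>] .
      show ?thesis
      proof (rule coclosedI[OF P], rule ce_diff_5_eq_0)
        show "?\<psi> [br x y, w, a, b] = 0" for x y w using r[of x y] by auto
        show "?\<psi> [br x b, u, v, a] = 0" for x u v using r[of x b] by auto
      qed (simp_all add: central \<open>a \<in> ?D\<close>)
    next
      case 2
      then obtain a b where ab: "B = {a, b}" "a \<noteq> b" by (auto simp: card_2_iff)
      have "b \<notin> span {a}" "a \<noteq> 0"
        using B(2) ab by (auto simp: insert_commute[of a b] independent_insert dependent_zero)
      then have P: "dot7 (coords e a) (coords e a) * dot7 (coords e b) (coords e b)
          - (dot7 (coords e a) (coords e b))\<^sup>2 \<noteq> 0"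
        using Gram_eq_0[OF fr, of a b] by (auto simp: span_singleton)
      have "br x y \<in> span {a, b}" for x y using brD B ab by blast
      then have r: "\<exists>r s. br x y = r *\<^sub>R a + s *\<^sub>R b" for x y
        by (auto simp: span_insert span_singleton) (metis diff_eq_eq add.commute)
      show ?thesis
      proof (rule coclosedI[OF P], rule ce_diff_5_eq_0)
        show "?\<psi> [br x y, w, a, b] = 0" for x y w using r[of x y] by auto
      qed (use B ab in \<open>simp_all add: central\<close>)
    qed
  next
    assume "dim ?D = 3 \<and> calibrates \<phi> ?D"
    then obtain a b c where D: "span {a, b, c} = ?D"
      and g: "dot7 (coords e a) (coords e a) = 1" "dot7 (coords e b) (coords e b) = 1"
        "dot7 (coords e c) (coords e c) = 1" "dot7 (coords e a) (coords e b) = 0"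
      and cal: "\<bar>\<phi> [a, b, c]\<bar> = 1"
      unfolding calibrates_def G2_metric_eq e_def[symmetric] by blast
    have "a \<in> ?D" "b \<in> ?D" unfolding D[symmetric] by (auto intro: span_base)
    have r: "\<exists>r s t. br x y = r *\<^sub>R a + (s *\<^sub>R b + t *\<^sub>R c)" for x y
      using brD[of x y] unfolding D[symmetric]
      by (auto simp: span_insert span_singleton) (metis diff_eq_eq add.commute)
    have P: "dot7 (coords e a) (coords e a) * dot7 (coords e b) (coords e b)
        - (dot7 (coords e a) (coords e b))\<^sup>2 \<noteq> 0"
      by (simp add: g)
    show ?thesis
    proof (rule coclosedI[OF P], rule ce_diff_5_eq_0)
      \<comment> \<open>The components of \<open>[x, y]\<close> along \<open>a\<close> and
        \<open>b\<close> repeat a slot; the one along \<open>c\<close> vanishes by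
        calibration.\<close>
      show "?\<psi> [br x y, w, a, b] = 0" for x y w
        using r[of x y] calibrated_triple[OF ad g cal] by (auto simp: coassociative_form_rotate[of e c])
    qed (simp_all add: central \<open>a \<in> ?D\<close> \<open>b \<in> ?D\<close>)
  qed
qed

end
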